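(* Let $(X,d)$ be a metric space and let $x\in X$ be fixed. Consider the map $\mathcal{B}_x:[0,\infty)\to CLB(X)$ given by $\mathcal{B}_x(t)=\overline{B}(x,t)$, where $CLB(X)$ carries the Hausdorff metric $H$. Then $\mathcal{B}_x$ is right-continuous (at every $t\in[0,\infty)$) if and only if the following property holds: for every $t\ge 0$ and every sequence $(y_n)$ in $X$, if $\lim_{n\to\infty} d(x,y_n)=t$ then $\lim_{n\to\infty} d\bigl(y_n,\overline{B}(x,t)\bigr)=0$.
   Context: For a metric space $(X,d)$, $\overline{B}(x,t)=\{y\in X: d(x,y)\le t\}$ denotes the closed ball with center $x$ and radius $t\ge 0$, and $d(y,A)=\inf_{a\in A}d(y,a)$ for nonempty $A\subset X$. $CLB(X)$ is the set of all nonempty closed bounded subsets of $X$, endowed with the Hausdorff metric $H(A,B)=\max\{\sup_{x\in A}d(x,B),\ \sup_{x\in B}d(x,A)\}$. *)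

theory Defs
  imports "HOL-Analysis.Analysis"
begin

text \<open>
  Real suprema are only meaningful for nonempty sets that are bounded above; for nonempty
  bounded \<open>A\<close> and \<open>B\<close> both index sets below satisfy this.
\<close>

definition hausdorff_dist :: "'a::metric_space set \<Rightarrow> 'a set \<Rightarrow> real" where
  "hausdorff_dist A B = max (SUP x\<in>A. infdist x B) (SUP x\<in>B. infdist x A)"

lemma bounded_bdd_above_infdist:
  assumes "bounded A" "B \<noteq> {}"
  shows "bdd_above ((\<lambda>x. infdist x B) ` A)"
proof -
  obtain b where b: "b \<in> B" using assms(2) by blast
  obtain e where e: "\<And>y. y \<in> A \<Longrightarrow> dist b y \<le> e"
    using assms(1) bounded_any_center[of A b] by blast
  show ?thesis
  proof (rule bdd_aboveI2)
    fix x assume "x \<in> A"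
    then show "infdist x B \<le> e"
      using infdist_le[OF b, of x] e[of x] by (simp add: dist_commute)
  qed
qed

lemma infdist_le_hausdorff_dist:
  assumes "bounded A" "B \<noteq> {}" "x \<in> A"
  shows "infdist x B \<le> hausdorff_dist A B"
  unfolding hausdorff_dist_def
  by (rule max.coboundedI1, rule cSUP_upper[OF assms(3) bounded_bdd_above_infdist[OF assms(1,2)]])

lemma hausdorff_dist_commute: "hausdorff_dist A B = hausdorff_dist B A"
  by (simp add: hausdorff_dist_def max.commute)

lemma hausdorff_dist_least:
  assumes "A \<noteq> {}" "B \<noteq> {}"
    and "\<And>x. x \<in> A \<Longrightarrow> infdist x B \<le> c" "\<And>x. x \<in> B \<Longrightarrow> infdist x A \<le> c"
  shows "hausdorff_dist A B \<le> c"
  unfolding hausdorff_dist_def using assms by (auto intro!: cSUP_least)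

lemma infdist_le_infdist_plus_hausdorff_dist:
  assumes "bounded B" "B \<noteq> {}" "C \<noteq> {}"
  shows "infdist x C \<le> infdist x B + hausdorff_dist B C"
proof -
  have "infdist x C - hausdorff_dist B C \<le> dist x b" if "b \<in> B" for b
    using infdist_triangle[of x C b] infdist_le_hausdorff_dist[OF assms(1,3) that] by simp
  then have "infdist x C - hausdorff_dist B C \<le> infdist x B"
    unfolding infdist_notempty[OF assms(2)] using assms(2) by (intro cINF_greatest)
  then show ?thesis by simp
qed

lemma hausdorff_dist_triangle:
  assumes "bounded A" "bounded B" "bounded C" "A \<noteq> {}" "B \<noteq> {}" "C \<noteq> {}"
  shows "hausdorff_dist A C \<le> hausdorff_dist A B + hausdorff_dist B C"
proof (rule hausdorff_dist_least)
  fix x assume "x \<in> A"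
  then show "infdist x C \<le> hausdorff_dist A B + hausdorff_dist B C"
    using infdist_le_infdist_plus_hausdorff_dist[of B C x]
      infdist_le_hausdorff_dist[of A B x] assms by simp
next
  fix x assume "x \<in> C"
  then show "infdist x A \<le> hausdorff_dist A B + hausdorff_dist B C"
    using infdist_le_infdist_plus_hausdorff_dist[of B A x]
      infdist_le_hausdorff_dist[of C B x] assms
    by (simp add: hausdorff_dist_commute[of B A] hausdorff_dist_commute[of C B])
qed (use assms in auto)

lemma hausdorff_dist_eq_0_iff:
  assumes "bounded A" "bounded B" "A \<noteq> {}" "B \<noteq> {}" "closed A" "closed B"
  shows "hausdorff_dist A B = 0 \<longleftrightarrow> A = B"
proof
  assume eq: "hausdorff_dist A B = 0"
  have "x \<in> B" if "x \<in> A" for x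
    using infdist_le_hausdorff_dist[of A B x] that eq assms infdist_nonneg[of x B]
    by (simp add: in_closed_iff_infdist_zero)
  moreover have "x \<in> A" if "x \<in> B" for x
    using infdist_le_hausdorff_dist[of B A x] that eq assms infdist_nonneg[of x A]
    by (simp add: in_closed_iff_infdist_zero hausdorff_dist_commute)
  ultimately show "A = B" by blast
next
  assume "A = B"
  then show "hausdorff_dist A B = 0"
    using assms by (simp add: hausdorff_dist_def cong: SUP_cong_simp)
qed

typedef (overloaded) 'a clb = "{A :: 'a::metric_space set. A \<noteq> {} \<and> closed A \<and> bounded A}"
  morphisms set_of_clb Abs_clb
  by (rule exI[of _ "{undefined}"]) simp

lemma set_of_clb [simp]:
  "set_of_clb A \<noteq> {}" "closed (set_of_clb A)" "bounded (set_of_clb A)"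
  using set_of_clb[of A] by auto

instantiation clb :: (metric_space) metric_space
begin

definition dist_clb :: "'a clb \<Rightarrow> 'a clb \<Rightarrow> real" where
  "dist_clb A B = hausdorff_dist (set_of_clb A) (set_of_clb B)"

definition uniformity_clb :: "('a clb \<times> 'a clb) filter" where
  "uniformity_clb = (INF e\<in>{0 <..}. principal {(A, B). dist A B < e})"

definition open_clb :: "'a clb set \<Rightarrow> bool" where
  "open_clb U = (\<forall>A\<in>U. \<forall>\<^sub>F (A', B) in uniformity. A' = A \<longrightarrow> B \<in> U)"

instance
proof
  fix A B C :: "'a clb"
  show "dist A B = 0 \<longleftrightarrow> A = B"
    by (simp add: dist_clb_def hausdorff_dist_eq_0_iff set_of_clb_inject)
  show "dist A B \<le> dist A C + dist B C"
    using hausdorff_dist_triangle[of "set_of_clb A" "set_of_clb C" "set_of_clb B"]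
    by (simp add: dist_clb_def hausdorff_dist_commute[of "set_of_clb B"])
qed (simp_all only: uniformity_clb_def open_clb_def)

end

text \<open>
  The map \<open>t \<mapsto> cball x t\<close> into the closed bounded sets.  It is only meant for \<open>t \<ge> 0\<close>; for
  \<open>t < 0\<close> the ball is empty and the value is unspecified.  This does not affect
  right-continuity at points \<open>t \<ge> 0\<close>, which only involves arguments \<open>s \<ge> t\<close>.
\<close>

definition clb_cball :: "'a::metric_space \<Rightarrow> real \<Rightarrow> 'a clb" where
  "clb_cball x t = Abs_clb (cball x t)"

lemma set_of_clb_cball: "t \<ge> 0 \<Longrightarrow> set_of_clb (clb_cball x t) = cball x t"
  unfolding clb_cball_def by (rule Abs_clb_inverse) (simp add: not_less)

end

theory Submission
  imports Defs
begin

text \<open>For \<open>t \<le> s\<close> the balls are nested, so their Hausdorff distance is just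
  the supremum of \<open>infdist y (cball x t)\<close> over \<open>y\<close> in
  \<open>cball x s\<close>. Right-continuity at \<open>t\<close> thus says that points whose
  distance to \<open>x\<close> barely exceeds \<open>t\<close> are uniformly close to
  \<open>cball x t\<close>, and the condition on sequences is the sequential form of this. The two
  bounds on the supremum are \<open>infdist_le_dist_clb_cball\<close> and
  \<open>dist_clb_cball_le\<close>; the equivalence already holds at each fixed radius.\<close>

lemma infdist_le_dist_clb_cball:
  assumes "0 \<le> s" "0 \<le> t" "y \<in> cball x s"
  shows "infdist y (cball x t) \<le> dist (clb_cball x s) (clb_cball x t)"
  unfolding dist_clb_def set_of_clb_cball[OF assms(1)] set_of_clb_cball[OF assms(2)]
  using assms by (intro infdist_le_hausdorff_dist) auto

text \<open>By nestedness the other half of the Hausdorff distance vanishes, so a one-sided bound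
  with \<open>0 \<le> c\<close> suffices.\<close>

lemma dist_clb_cball_le:
  assumes "0 \<le> t" "t \<le> s" "0 \<le> c" "\<And>y. y \<in> cball x s \<Longrightarrow> infdist y (cball x t) \<le> c"
  shows "dist (clb_cball x s) (clb_cball x t) \<le> c"
proof -
  have "infdist y (cball x s) \<le> c" if "y \<in> cball x t" for y
    using that assms(2,3) by simp
  then show ?thesis
    unfolding dist_clb_def set_of_clb_cball[OF assms(1)]
      set_of_clb_cball[OF order_trans[OF assms(1,2)]]
    using assms by (intro hausdorff_dist_least) auto
qed

lemma continuous_at_right_clb_cball_iff:
  assumes "0 \<le> t"
  shows "continuous (at_right t) (clb_cball x) \<longleftrightarrow>
    (\<forall>y :: nat \<Rightarrow> 'a::metric_space. (\<lambda>n. dist x (y n)) \<longlonglongrightarrow> t \<longrightarrow>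
       (\<lambda>n. infdist (y n) (cball x t)) \<longlonglongrightarrow> 0)"
    (is "?cont \<longleftrightarrow> ?seq")
proof
  assume cont: ?cont
  show ?seq
  proof (intro allI impI)
    fix y :: "nat \<Rightarrow> 'a"
    assume y: "(\<lambda>n. dist x (y n)) \<longlonglongrightarrow> t"
    show "(\<lambda>n. infdist (y n) (cball x t)) \<longlonglongrightarrow> 0"
    proof (rule tendstoI)
      fix e :: real
      assume "0 < e"
      then have "\<forall>\<^sub>F s in at_right t. dist (clb_cball x s) (clb_cball x t) < e"
        using cont by (simp add: continuous_within tendsto_iff)
      then obtain b where b: "t < b"
        "\<And>s. t < s \<Longrightarrow> s < b \<Longrightarrow> dist (clb_cball x s) (clb_cball x t) < e"
        unfolding eventually_at_right_field by blast
      show "\<forall>\<^sub>F n in sequentially. dist (infdist (y n) (cball x t)) 0 < e"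
        using order_tendstoD(2)[OF y b(1)]
      proof eventually_elim
        case (elim n)
        show ?case
        \<comment> \<open>The sequence may approach \<open>t\<close> from below or equal it, where
          right-continuity says nothing; but then \<open>y n\<close> lies in the ball and its
          distance to it is 0. Otherwise \<open>dist x (y n)\<close> itself serves as the radius
          \<open>s\<close>.\<close>
        proof (cases "dist x (y n) \<le> t")
          case True
          then show ?thesis using \<open>0 < e\<close> by simp
        next
          case False
          then show ?thesis
            using infdist_le_dist_clb_cball[of "dist x (y n)" t "y n" x] b(2)[OF _ elim]
              assms infdist_nonneg[of "y n" "cball x t"] by simp
        qed
      qed
    qed
  qed
next
  assume seq: ?seq
  have "\<forall>\<^sub>F s in at_right t. dist (clb_cball x s) (clb_cball x t) < e" if "0 < e" for e
  proof (rule ccontr)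
    assume not_ev: "\<not> ?thesis"
    have "\<exists>y. t < dist x y \<and> dist x y < t + inverse (real (Suc n)) \<and>
        e / 2 < infdist y (cball x t)" for n
    proof -
      have "t < t + inverse (real (Suc n))" by simp
      then obtain s where s: "t < s" "s < t + inverse (real (Suc n))"
        "\<not> dist (clb_cball x s) (clb_cball x t) < e"
        using not_ev unfolding eventually_at_right_field by blast
      \<comment> \<open>The supremum need not be attained, so \<open>e\<close> is lowered to
        \<open>e / 2\<close>: were every point of \<open>cball x s\<close> within
        \<open>e / 2\<close>, the Hausdorff distance would be below \<open>e\<close>.\<close>
      then obtain y where y: "y \<in> cball x s" "e / 2 < infdist y (cball x t)"
        using dist_clb_cball_le[OF assms, of s "e / 2" x] \<open>0 < e\<close> by fastforce
      \<comment> \<open>A point at positive distance from the ball is outside it; this gives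
        \<open>t < dist x y\<close>, the lower bound for the squeeze below.\<close>
      then have "y \<notin> cball x t"
        using \<open>0 < e\<close> by auto
      with y s show ?thesis by (intro exI[of _ y]) auto
    qed
    then obtain y where y: "\<And>n. t < dist x (y n)"
      "\<And>n. dist x (y n) < t + inverse (real (Suc n))"
      "\<And>n. e / 2 < infdist (y n) (cball x t)"
      by metis
    have "(\<lambda>n. dist x (y n)) \<longlonglongrightarrow> t"
      using y(1,2)
      by (intro tendsto_sandwich[OF _ _ tendsto_const LIMSEQ_inverse_real_of_nat_add])
        (auto intro!: always_eventually less_imp_le)
    then have "(\<lambda>n. infdist (y n) (cball x t)) \<longlonglongrightarrow> 0"
      using seq by blast
    \<comment> \<open>The uniform lower bound \<open>e / 2\<close> survives in the limit 0.\<close>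
    then have "e / 2 \<le> 0"
      by (rule LIMSEQ_le_const) (use y(3) less_imp_le in blast)
    with \<open>0 < e\<close> show False by simp
  qed
  then show ?cont
    by (simp add: continuous_within tendsto_iff)
qed

theorem theorem1:
  fixes x :: "'a::metric_space"
  shows "(\<forall>t\<ge>0. continuous (at_right t) (clb_cball x)) \<longleftrightarrow>
    (\<forall>t\<ge>0. \<forall>y :: nat \<Rightarrow> 'a. (\<lambda>n. dist x (y n)) \<longlonglongrightarrow> t \<longrightarrow>
       (\<lambda>n. infdist (y n) (cball x t)) \<longlonglongrightarrow> 0)"
  using continuous_at_right_clb_cball_iff[of _ x] by blast

end
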